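(* Let $G$ be a finite connected graph. Then $$\max\{\sigma^{\times}_{V}(G),\sigma^{\square}_{V}(G)\}\le\sigma^{\boxtimes}_{V}(G)\le \max\{\sigma^{\times}_{V}(G),\sigma^{\square}_{V}(G)\}+1.$$
   Context: All graphs are finite, simple, nonempty and connected; $\mathbb{N}_l=\{1,\dots,l\}$ (with $\mathbb{N}_0=\emptyset$), and $d_G$ is the usual shortest-path distance. Let $G$ be a graph and $l\in\mathbb{N}$, $l\ge 1$. A surjective function $f:\mathbb{N}_l\to V(G)$ is an $l$-track on $G$ if $f(i)f(i+1)\in E(G)$ for every $i\in\mathbb{N}_{l-1}$; it is a lazy $l$-track if for every $i\in\mathbb{N}_{l-1}$ either $f(i)f(i+1)\in E(G)$ or $f(i)=f(i+1)$. Two lazy $l$-tracks $f,g$ are opposite if for all $i\in\mathbb{N}_{l-1}$: $f(i)f(i+1)\in E(G)\iff g(i)=g(i+1)$. For lazy $l$-tracks $f,g$ put $m_G(f,g)=\min\{d_G(f(i),g(i)) : i\in\mathbb{N}_l\}$. The strong vertex span $\sigma^{\boxtimes}_V(G)$, the direct vertex span $\sigma^{\times}_V(G)$ and the Cartesian vertex span $\sigma^{\square}_V(G)$ are the maximum of $m_G(f,g)$ over all $l$ and all pairs $(f,g)$ of, respectively, lazy $l$-tracks, $l$-tracks, opposite lazy $l$-tracks on $G$. *)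

theory Defs
  imports "Graph_Theory.Graph_Theory"
begin

text \<open>
  Graphs are those of \<^locale>\<open>graph\<close>: finite, loop-free digraphs without parallel arcs whose
  adjacency relation \<open>u \<rightarrow>\<^bsub>G\<^esub> v\<close> is symmetric. The library's graph-theoretic
  connectedness includes nonemptiness.
\<close>

definition graph_dist :: "('a, 'b) pre_digraph \<Rightarrow> 'a \<Rightarrow> 'a \<Rightarrow> nat" where
  "graph_dist G u v = (LEAST n. \<exists>p. pre_digraph.apath G u p v \<and> length p = n)"

text \<open>On reachable pairs this is the library's shortest-path distance with unit arc weights.\<close>

lemma (in fin_digraph) mu_unit_eq_graph_dist:
  assumes "u \<rightarrow>\<^sup>* v"
  shows "\<mu> (\<lambda>_. 1) u v = ereal (real (graph_dist G u v))"
proof -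
  have cost: "awalk_cost (\<lambda>_. 1) p = real (length p)" for p
    by (induct p) (auto simp: awalk_cost_def)
  obtain p where p: "apath u p v" "\<mu> (\<lambda>_. 1) u v = ereal (real (length p))"
    using min_cost_awalk[OF assms, of "\<lambda>_. 1"] by (auto simp: cost)
  have "length p \<le> length q" if "apath u q v" for q
    using min_cost_le_walk_cost[OF awalkI_apath[OF that], of "\<lambda>_. 1"] p(2) by (simp add: cost)
  then have "graph_dist G u v = length p"
    unfolding graph_dist_def using p(1) by (intro Least_equality) auto
  then show ?thesis using p(2) by simp
qed

text \<open>
  A function on \<open>{1, \<dots>, l}\<close> is represented by a total function on the naturals whose values
  outside \<open>{1..l}\<close> are irrelevant. The index set \<open>{1, \<dots>, l - 1}\<close> is \<open>{1..<l}\<close>.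
\<close>

definition is_track :: "('a, 'b) pre_digraph \<Rightarrow> nat \<Rightarrow> (nat \<Rightarrow> 'a) \<Rightarrow> bool" where
  "is_track G l f \<longleftrightarrow> l \<ge> 1 \<and> f ` {1..l} = verts G \<and>
     (\<forall>i\<in>{1..<l}. f i \<rightarrow>\<^bsub>G\<^esub> f (i + 1))"

definition is_lazy_track :: "('a, 'b) pre_digraph \<Rightarrow> nat \<Rightarrow> (nat \<Rightarrow> 'a) \<Rightarrow> bool" where
  "is_lazy_track G l f \<longleftrightarrow> l \<ge> 1 \<and> f ` {1..l} = verts G \<and>
     (\<forall>i\<in>{1..<l}. f i \<rightarrow>\<^bsub>G\<^esub> f (i + 1) \<or> f i = f (i + 1))"

definition opposite_lazy_tracks ::
    "('a, 'b) pre_digraph \<Rightarrow> nat \<Rightarrow> (nat \<Rightarrow> 'a) \<Rightarrow> (nat \<Rightarrow> 'a) \<Rightarrow> bool" where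
  "opposite_lazy_tracks G l f g \<longleftrightarrow> is_lazy_track G l f \<and> is_lazy_track G l g \<and>
     (\<forall>i\<in>{1..<l}. f i \<rightarrow>\<^bsub>G\<^esub> f (i + 1) \<longleftrightarrow> g i = g (i + 1))"

definition track_dist ::
    "('a, 'b) pre_digraph \<Rightarrow> nat \<Rightarrow> (nat \<Rightarrow> 'a) \<Rightarrow> (nat \<Rightarrow> 'a) \<Rightarrow> nat" where
  "track_dist G l f g = Min ((\<lambda>i. graph_dist G (f i) (g i)) ` {1..l})"

text \<open>
  For a connected graph the three sets below are finite (there are finitely many distances) and
  nonempty (opposite pairs: one track moves while the other one waits, and then conversely), so
  \<^const>\<open>Max\<close> is a genuine maximum.
\<close>

definition strong_vertex_span :: "('a, 'b) pre_digraph \<Rightarrow> nat" where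
  "strong_vertex_span G =
     Max {track_dist G l f g | l f g. is_lazy_track G l f \<and> is_lazy_track G l g}"

definition direct_vertex_span :: "('a, 'b) pre_digraph \<Rightarrow> nat" where
  "direct_vertex_span G =
     Max {track_dist G l f g | l f g. is_track G l f \<and> is_track G l g}"

definition cartesian_vertex_span :: "('a, 'b) pre_digraph \<Rightarrow> nat" where
  "cartesian_vertex_span G =
     Max {track_dist G l f g | l f g. opposite_lazy_tracks G l f g}"

end

theory Submission
  imports Defs
begin

text \<open>
  The lower bound holds because tracks and opposite lazy tracks are lazy tracks.

  For the upper bound it suffices to compare with the Cartesian span. Take two lazy tracks that
  stay at distance at least \<open>k\<close> and make them opposite: drop the instants at which both wait, and
  split every instant at which both move into two, the second track moving first and the first
  track following. The only new pairs of positions arise half-way through such a split; there a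
  single vertex has been moved along a single edge, so the distance is at least \<open>k - 1\<close>
  (\<open>sequentialize\<close>).

  The spans are maxima of sets of naturals, so they have their intended meaning only once these
  sets are known to be finite and nonempty. A walk through all vertices, obtained by
  concatenating paths (\<open>spanning_trace\<close>), shows that tracks exist, and sequentializing two copies
  of one yields opposite lazy tracks.

  Reindexing of sequences is avoided by working with the set of values and the last value of
  a finite walk, which is all that matters for surjectivity and distances, and by regarding a
  pair of tracks as one walk on pairs of vertices.
\<close>

section \<open>Finite walks by their set of values and their endpoint\<close>

inductive trace :: "('v \<Rightarrow> 'v \<Rightarrow> bool) \<Rightarrow> 'v set \<Rightarrow> 'v \<Rightarrow> bool" for R where
  start: "trace R {x} x"
| move: "trace R A x \<Longrightarrow> R x y \<Longrightarrow> trace R (insert y A) y"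

lemma trace_of_sequence:
  fixes l :: nat
  assumes "1 \<le> l" "\<And>i. i \<in> {1..<l} \<Longrightarrow> R (h i) (h (i + 1))"
  shows "trace R (h ` {1..l}) (h l)"
  using assms
proof (induction l rule: dec_induct)
  case base
  then show ?case using start[of R "h 1"] by simp
next
  case (step n)
  then have "trace R (insert (h (Suc n)) (h ` {1..n})) (h (Suc n))"
    by (intro move[of R _ "h n"]) auto
  moreover have "{1..Suc n} = insert (Suc n) {1..n}" by auto
  ultimately show ?case by simp
qed

lemma sequence_of_trace:
  assumes "trace R A x"
  obtains l :: nat and h where "1 \<le> l" "h ` {1..l} = A" "h l = x"
    "\<forall>i\<in>{1..<l}. R (h i) (h (i + 1))"
proof -
  have "\<exists>l h. (1::nat) \<le> l \<and> h ` {1..l} = A \<and> h l = x \<and> (\<forall>i\<in>{1..<l}. R (h i) (h (i + 1)))"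
    using assms
  proof induction
    case (start x)
    have "(\<lambda>_. x) ` {1..1::nat} = {x}" by simp
    then show ?case by (intro exI[of _ 1] exI[of _ "\<lambda>_. x"]) simp
  next
    case (move A x y)
    then obtain l :: nat and h where h: "1 \<le> l" "h ` {1..l} = A" "h l = x"
      "\<forall>i\<in>{1..<l}. R (h i) (h (i + 1))" by blast
    let ?h = "h(Suc l := y)"
    have "{1..Suc l} = insert (Suc l) {1..l}" by auto
    moreover have "?h ` {1..l} = h ` {1..l}" by (intro image_cong) auto
    ultimately have "?h ` {1..Suc l} = insert y A"
      using h(2) by (simp only: image_insert fun_upd_same)
    moreover have "R (?h i) (?h (i + 1))" if "i \<in> {1..<Suc l}" for i
      using that h move.hyps(2) by (cases "i = l") auto
    ultimately show ?case by (intro exI[of _ "Suc l"] exI[of _ ?h]) auto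
  qed
  then show thesis using that by blast
qed

section \<open>Walks of pairs of vertices\<close>

abbreviation lazy_move :: "('a, 'b) pre_digraph \<Rightarrow> 'a \<times> 'a \<Rightarrow> 'a \<times> 'a \<Rightarrow> bool" where
  "lazy_move G p q \<equiv> (fst p \<rightarrow>\<^bsub>G\<^esub> fst q \<or> fst p = fst q) \<and> (snd p \<rightarrow>\<^bsub>G\<^esub> snd q \<or> snd p = snd q)"

abbreviation opposite_move :: "('a, 'b) pre_digraph \<Rightarrow> 'a \<times> 'a \<Rightarrow> 'a \<times> 'a \<Rightarrow> bool" where
  "opposite_move G p q \<equiv>
     fst p \<rightarrow>\<^bsub>G\<^esub> fst q \<and> snd p = snd q \<or> fst p = fst q \<and> snd p \<rightarrow>\<^bsub>G\<^esub> snd q"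

lemma is_track_imp_is_lazy_track: "is_track G l f \<Longrightarrow> is_lazy_track G l f"
  by (auto simp: is_track_def is_lazy_track_def)

lemma lazy_tracks_imp_trace:
  assumes "is_lazy_track G l f" "is_lazy_track G l g"
  shows "trace (lazy_move G) ((\<lambda>i. (f i, g i)) ` {1..l}) (f l, g l)"
  using assms unfolding is_lazy_track_def
  by (intro trace_of_sequence[where h = "\<lambda>i. (f i, g i)"]) auto

lemma (in loopfree_digraph) not_adj_self: "\<not> v \<rightarrow> v"
  using no_loops by (auto simp: arcs_ends_def arc_to_ends_def)

lemma (in loopfree_digraph) trace_imp_opposite_lazy_tracks:
  assumes "trace (opposite_move G) D q" "fst ` D = verts G" "snd ` D = verts G"
  obtains l f g where "opposite_lazy_tracks G l f g" "(\<lambda>i. (f i, g i)) ` {1..l} = D"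
proof -
  obtain l :: nat and h where h: "1 \<le> l" "h ` {1..l} = D" "h l = q"
    "\<forall>i\<in>{1..<l}. opposite_move G (h i) (h (i + 1))"
    using sequence_of_trace[OF assms(1)] .
  let ?f = "fst \<circ> h" and ?g = "snd \<circ> h"
  have "?f ` {1..l} = verts G" "?g ` {1..l} = verts G"
    using h(2) assms(2,3) by (simp_all only: image_comp[symmetric])
  \<comment> \<open>Without loops a vertex cannot both wait and move, so each opposite move lets exactly one of
    the two components move; the equivalence needs this exclusiveness.\<close>
  moreover have "(?f i \<rightarrow> ?f (i + 1) \<or> ?f i = ?f (i + 1)) \<and>
      (?g i \<rightarrow> ?g (i + 1) \<or> ?g i = ?g (i + 1)) \<and>
      (?f i \<rightarrow> ?f (i + 1) \<longleftrightarrow> ?g i = ?g (i + 1))" if "i \<in> {1..<l}" for i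
    using bspec[OF h(4) that] not_adj_self by (metis comp_apply)
  ultimately have "opposite_lazy_tracks G l ?f ?g"
    using h(1) unfolding opposite_lazy_tracks_def is_lazy_track_def by blast
  then show thesis using that h(2) by simp
qed

section \<open>Distances\<close>

lemma le_track_dist_iff:
  assumes "1 \<le> l"
  shows "k \<le> track_dist G l f g \<longleftrightarrow> (\<forall>i\<in>{1..l}. k \<le> graph_dist G (f i) (g i))"
  using assms unfolding track_dist_def by (subst Min_ge_iff) auto

lemma finite_track_dists:
  assumes "finite (verts G)"
    and "\<And>l f g. P l f g \<Longrightarrow> is_lazy_track G l f \<and> is_lazy_track G l g"
  shows "finite {track_dist G l f g | l f g. P l f g}"
proof (rule finite_subset)
  show "{track_dist G l f g | l f g. P l f g}
    \<subseteq> (\<lambda>(u, v). graph_dist G u v) ` (verts G \<times> verts G)"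
  proof clarify
    fix l f g assume "P l f g"
    then have lazy: "1 \<le> l" "f ` {1..l} = verts G" "g ` {1..l} = verts G"
      using assms(2) by (auto simp: is_lazy_track_def)
    then have "track_dist G l f g \<in> (\<lambda>i. graph_dist G (f i) (g i)) ` {1..l}"
      unfolding track_dist_def by (intro Min_in) auto
    then show "track_dist G l f g \<in> (\<lambda>(u, v). graph_dist G u v) ` (verts G \<times> verts G)"
      using lazy by force
  qed
  show "finite ((\<lambda>(u, v). graph_dist G u v) ` (verts G \<times> verts G))"
    using assms(1) by simp
qed

lemma (in fin_digraph) graph_dist_adj_le:
  assumes "s \<rightarrow>\<^sup>* u" "u \<rightarrow> v"
  shows "graph_dist G s v \<le> graph_dist G s u + 1"
proof -
  obtain e where e: "e \<in> arcs G" "arc_to_ends G e = (u, v)"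
    using assms(2) by (auto simp: arcs_ends_def)
  have "s \<rightarrow>\<^sup>* v" using assms by (rule reachable_adj_trans)
  then have "ereal (real (graph_dist G s v)) \<le> ereal (real (graph_dist G s u)) + 1"
    using pos_cost_mu_triangle[OF _ e(2,1), of "\<lambda>_. 1" s] assms(1)
    by (simp add: mu_unit_eq_graph_dist one_ereal_def)
  then show ?thesis by (simp add: one_ereal_def)
qed

section \<open>Walks in a connected graph\<close>

lemma (in wf_digraph) trace_subset_verts:
  assumes "trace (dominates G) A x" "x \<in> verts G"
  shows "A \<subseteq> verts G"
  using assms by induction (auto dest: adj_in_verts)

lemma (in wf_digraph) trace_extend:
  assumes "x \<rightarrow>\<^sup>* y" "trace (dominates G) A x"
  shows "\<exists>B. trace (dominates G) B y \<and> A \<subseteq> B"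
  using assms
proof (induction rule: reachable_induct)
  case base
  then show ?case by blast
next
  case (step y z)
  then show ?case by (meson move subset_insertI2)
qed

lemma (in wf_digraph) spanning_trace:
  assumes "finite (verts G)" "strongly_connected G"
  obtains x where "trace (dominates G) (verts G) x"
proof -
  have "\<exists>A x. trace (dominates G) A x \<and> x \<in> verts G \<and> S \<subseteq> A"
    if "finite S" "S \<subseteq> verts G" for S
    using that
  proof (induction rule: finite_induct)
    case empty
    show ?case using start assms(2) by (fastforce simp: strongly_connected_def)
  next
    case (insert v S)
    then obtain A x where A: "trace (dominates G) A x" "x \<in> verts G" "S \<subseteq> A" by auto
    have v: "v \<in> verts G" using insert.prems by simp
    then have "x \<rightarrow>\<^sup>* v" using A(2) assms(2) by auto
    then obtain B where B: "trace (dominates G) B v" "A \<subseteq> B"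
      using trace_extend A(1) by blast
    have "v \<in> B" using B(1) by cases auto
    then show ?case using A(3) B v by blast
  qed
  from this[OF assms(1) order_refl] obtain A x
    where A: "trace (dominates G) A x" "x \<in> verts G" "verts G \<subseteq> A" by blast
  then have "A = verts G" using trace_subset_verts by blast
  then show thesis using A(1) that by blast
qed

lemma (in wf_digraph) ex_track:
  assumes "finite (verts G)" "strongly_connected G"
  obtains l f where "is_track G l f"
proof -
  obtain x where "trace (dominates G) (verts G) x" using spanning_trace[OF assms] .
  then obtain l :: nat and f where "1 \<le> l" "f ` {1..l} = verts G" "f l = x"
    "\<forall>i\<in>{1..<l}. f i \<rightarrow> f (i + 1)"
    by (rule sequence_of_trace)
  then show thesis using that by (auto simp: is_track_def)
qed

text \<open>
  A simultaneous move from \<open>(a, b)\<close> to \<open>(c, d)\<close> becomes two moves through \<open>(a, d)\<close>. Since \<open>b\<close> and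
  \<open>d\<close> are adjacent, \<open>(a, d)\<close> loses at most one unit of distance against \<open>(a, b)\<close>, and losses do not
  accumulate because the new pair is compared with an original one. Both components keep their
  sets of values, so surjectivity survives.
\<close>

lemma (in pseudo_graph) sequentialize:
  assumes "strongly_connected G"
    and "trace (lazy_move G) C p" "C \<subseteq> verts G \<times> verts G"
    and "\<And>u v. (u, v) \<in> C \<Longrightarrow> k \<le> graph_dist G u v"
  shows "\<exists>D. trace (opposite_move G) D p \<and> fst ` D = fst ` C \<and> snd ` D = snd ` C \<and>
    (\<forall>(u, v) \<in> D. k \<le> graph_dist G u v + 1)"
  using assms(2-)
proof induction
  case (start p)
  then have "\<forall>(u, v) \<in> {p}. k \<le> graph_dist G u v + 1" by fastforce
  then show ?case by (intro exI[of _ "{p}"]) (simp add: trace.start)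
next
  case (move C p q)
  obtain a b where p: "p = (a, b)" by fastforce
  obtain c d where q: "q = (c, d)" by fastforce
  obtain D where D: "trace (opposite_move G) D p" "fst ` D = fst ` C" "snd ` D = snd ` C"
    "\<forall>(u, v) \<in> D. k \<le> graph_dist G u v + 1"
    using move by auto
  have "p \<in> C" using move.hyps(1) by cases auto
  have "p \<in> D" using D(1) by cases auto
  have dist_q: "k \<le> graph_dist G c d + 1" using move.prems(2)[of c d] q by simp
  consider "p = q" | "opposite_move G p q" | "a \<rightarrow> c" "b \<rightarrow> d"
    using move.hyps(2) p q by auto
  then show ?case
  proof cases
    case 1
    then show ?thesis using D \<open>p \<in> C\<close> by (intro exI[of _ D]) (auto simp: insert_absorb)
  next
    case 2
    have "trace (opposite_move G) (insert q D) q" using D(1) 2 by (rule trace.move)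
    then show ?thesis using D dist_q q by (intro exI[of _ "insert q D"]) auto
  next
    case 3
    have verts: "a \<in> verts G" "d \<in> verts G"
      using 3 by (auto dest: adj_in_verts)
    then have "a \<rightarrow>\<^sup>* d" using assms(1) by auto
    moreover have "d \<rightarrow> b" using 3(2) by (simp add: graph_symmetric)
    ultimately have "graph_dist G a b \<le> graph_dist G a d + 1" by (rule graph_dist_adj_le)
    moreover have "k \<le> graph_dist G a b" using move.prems(2)[of a b] \<open>p \<in> C\<close> p by simp
    ultimately have dist: "k \<le> graph_dist G a d + 1" by simp
    have "trace (opposite_move G) (insert (a, d) D) (a, d)"
      using D(1) 3 p by (intro trace.move[OF D(1)]) auto
    then have "trace (opposite_move G) (insert q (insert (a, d) D)) q"
      by (rule trace.move) (use 3 q in auto)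
    moreover have "a \<in> fst ` C" using \<open>p \<in> C\<close> p by force
    ultimately show ?thesis
      using D dist dist_q q by (intro exI[of _ "insert q (insert (a, d) D)"]) auto
  qed
qed

lemma (in graph) ex_opposite_lazy_tracks:
  assumes "strongly_connected G" "is_lazy_track G l f" "is_lazy_track G l g"
  obtains m f' g' where "opposite_lazy_tracks G m f' g'"
    "track_dist G l f g \<le> track_dist G m f' g' + 1"
proof -
  let ?C = "(\<lambda>i. (f i, g i)) ` {1..l}" and ?k = "track_dist G l f g"
  have lazy: "1 \<le> l" "f ` {1..l} = verts G" "g ` {1..l} = verts G"
    using assms(2,3) by (auto simp: is_lazy_track_def)
  have "\<exists>D. trace (opposite_move G) D (f l, g l) \<and> fst ` D = fst ` ?C \<and> snd ` D = snd ` ?C \<and>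
    (\<forall>(u, v) \<in> D. ?k \<le> graph_dist G u v + 1)"
  proof (rule sequentialize[OF assms(1) lazy_tracks_imp_trace[OF assms(2,3)]])
    show "?C \<subseteq> verts G \<times> verts G" using lazy(2,3) by auto
    show "?k \<le> graph_dist G u v" if "(u, v) \<in> ?C" for u v
      using that le_track_dist_iff[OF lazy(1), of ?k G f g] by auto
  qed
  then obtain D where D: "trace (opposite_move G) D (f l, g l)"
    "fst ` D = verts G" "snd ` D = verts G" "\<forall>(u, v) \<in> D. ?k \<le> graph_dist G u v + 1"
    using lazy(2,3) by (auto simp: image_image)
  obtain m f' g' where opp: "opposite_lazy_tracks G m f' g'"
    and m: "(\<lambda>i. (f' i, g' i)) ` {1..m} = D"
    using trace_imp_opposite_lazy_tracks[OF D(1-3)] .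
  have "1 \<le> m" using opp by (simp add: opposite_lazy_tracks_def is_lazy_track_def)
  moreover have "?k - 1 \<le> graph_dist G (f' i) (g' i)" if "i \<in> {1..m}" for i
  proof -
    have "(f' i, g' i) \<in> D" using m that by blast
    then have "?k \<le> graph_dist G (f' i) (g' i) + 1" using D(4) by blast
    then show ?thesis by simp
  qed
  ultimately have "?k - 1 \<le> track_dist G m f' g'" by (simp add: le_track_dist_iff)
  then show thesis using that[OF opp] by simp
qed

section \<open>Comparison of the spans\<close>

theorem corollary5p11:
  fixes G :: "('a, 'b) pre_digraph"
  assumes "graph G" and "Digraph_Component.connected G"
  shows "max (direct_vertex_span G) (cartesian_vertex_span G) \<le> strong_vertex_span G \<and>
         strong_vertex_span G \<le> max (direct_vertex_span G) (cartesian_vertex_span G) + 1"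
proof -
  interpret graph G by fact
  have conn: "strongly_connected G"
    using symmetric_connected_imp_strongly_connected[OF sym_arcs assms(2)] .
  let ?S = "{track_dist G l f g | l f g. is_lazy_track G l f \<and> is_lazy_track G l g}"
  let ?X = "{track_dist G l f g | l f g. is_track G l f \<and> is_track G l g}"
  let ?Q = "{track_dist G l f g | l f g. opposite_lazy_tracks G l f g}"
  have fin: "finite ?S" "finite ?Q"
    by (rule finite_track_dists; simp add: opposite_lazy_tracks_def)+
  obtain l f where f: "is_track G l f" using ex_track[OF finite_verts conn] .
  then have "?X \<noteq> {}" by blast
  moreover have XS: "?X \<subseteq> ?S" using is_track_imp_is_lazy_track by blast
  ultimately have "direct_vertex_span G \<le> strong_vertex_span G"
    unfolding direct_vertex_span_def strong_vertex_span_def by (intro Max_mono fin(1))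
  moreover have "cartesian_vertex_span G \<le> strong_vertex_span G"
  proof -
    have lazy: "is_lazy_track G l f" using f by (rule is_track_imp_is_lazy_track)
    obtain m f' g' where "opposite_lazy_tracks G m f' g'"
      using ex_opposite_lazy_tracks[OF conn lazy lazy] .
    then have "?Q \<noteq> {}" by blast
    moreover have "?Q \<subseteq> ?S" unfolding opposite_lazy_tracks_def by blast
    ultimately show ?thesis
      unfolding cartesian_vertex_span_def strong_vertex_span_def by (intro Max_mono fin(1))
  qed
  moreover have "strong_vertex_span G \<le> cartesian_vertex_span G + 1"
  proof -
    have "strong_vertex_span G \<in> ?S"
      unfolding strong_vertex_span_def
    proof (intro Max_in fin(1))
      show "?S \<noteq> {}" using XS \<open>?X \<noteq> {}\<close> by blast
    qed
    then obtain l f g where fg: "is_lazy_track G l f" "is_lazy_track G l g"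
      and s: "strong_vertex_span G = track_dist G l f g" by blast
    obtain m f' g' where opp: "opposite_lazy_tracks G m f' g'"
      and le: "track_dist G l f g \<le> track_dist G m f' g' + 1"
      using ex_opposite_lazy_tracks[OF conn fg] .
    have "track_dist G m f' g' \<le> cartesian_vertex_span G"
      unfolding cartesian_vertex_span_def using opp by (intro Max_ge fin(2)) blast
    then show ?thesis using s le by simp
  qed
  ultimately show ?thesis by simp
qed

end
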